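(* Let $\mathcal{Q}$ denote the set of all global real optimistic solutions of the bilevel problem and assume that $\mathcal{Q}$ is nonempty. Define $$\mathcal{T}=\{x\in\mathcal{Q} \mid \text{there exists } y\in\psi(x) \text{ with } F_o(x)=F(x,y)\}.$$ (I) If $\mathcal{T}$ is empty, then every point of $\mathcal{Q}$ is a global $l$-minimal solution of the set-valued formulation. (II) If $\mathcal{T}$ is nonempty, then every point of $\mathcal{T}$ is a global $l$-minimal solution of the set-valued formulation, and no element of $\mathcal{Q}\setminus\mathcal{T}$ is a global $l$-minimal solution of the set-valued formulation.
   Context: Setting. $\mathcal{X},\mathcal{Y}$ are real normed linear spaces, $X\subseteq\mathcal{X}$ is nonempty, $F:\mathcal{X}\times\mathcal{Y}\to\mathbb{R}$ is the upper-level objective. For each $x\in X$, $K(x)\subseteq\mathcal{Y}$ is the lower-level constraint set, $f$ is the real-valued lower-level objective, and $\psi(x)=\arg\min_y\{f(x,y)\mid y\in K(x)\}$ is the set of global minimizers of $f(x,\cdot)$ over $K(x)$. Standing assumption: $\psi(x)\neq\emptyset$ for every $x\in X$. The bilevel problem is: "minimize" over $x$ the value $F(x,y)$ subject to $x\in X$, $y\in\psi(x)$. $F_o(x)=\inf_{y\in\psi(x)}F(x,y)$ for $x\in X$ (possibly $-\infty$; attainment is not assumed). A point $x^*\in X$ is a global real optimistic solution of the bilevel problem if $F_o(x)\ge F_o(x^* )$ for all $x\in X$. Set-valued formulation: minimize $F(x,\psi(x))$ over $x\in X$, where $F(x,\psi(x)):=\{F(x,y)\mid y\in\psi(x)\}\subseteq\mathbb{R}$.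 $\mathbb{R}$ carries its usual order, induced by the cone $C=\mathbb{R}_+=[0,\infty)$. For nonempty $A,B\subseteq\mathbb{R}$, $A\le_C^l B$ means $B\subseteq A+C$. A point $x^0\in X$ is a global $l$-minimal solution of the set-valued formulation if for every $x\in X$ with $F(x,\psi(x))\le_C^l F(x^0,\psi(x^0))$ one has $F(x^0,\psi(x^0))\le_C^l F(x,\psi(x))$. *)

theory Defs
  imports "HOL-Analysis.Analysis" "HOL-Library.Set_Algebras"
begin

definition lower_level_solutions ::
    "('a \<times> 'b \<Rightarrow> real) \<Rightarrow> ('a \<Rightarrow> 'b set) \<Rightarrow> 'a \<Rightarrow> 'b set" where
  "lower_level_solutions f K x = {y. is_arg_min (\<lambda>y. f (x, y)) (\<lambda>y. y \<in> K x) y}"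

(* The infimum is taken in ereal because it may be -infinity. *)
definition optimistic_value ::
    "('a \<times> 'b \<Rightarrow> real) \<Rightarrow> ('a \<Rightarrow> 'b set) \<Rightarrow> 'a \<Rightarrow> ereal" where
  "optimistic_value F \<psi> x = (INF y\<in>\<psi> x. ereal (F (x, y)))"

definition global_real_optimistic_solution ::
    "('a \<times> 'b \<Rightarrow> real) \<Rightarrow> 'a set \<Rightarrow> ('a \<Rightarrow> 'b set) \<Rightarrow> 'a \<Rightarrow> bool" where
  "global_real_optimistic_solution F X \<psi> x\<^sub>0 \<longleftrightarrow>
     x\<^sub>0 \<in> X \<and> (\<forall>x\<in>X. optimistic_value F \<psi> x \<ge> optimistic_value F \<psi> x\<^sub>0)"

definition upper_value_set ::
    "('a \<times> 'b \<Rightarrow> real) \<Rightarrow> ('a \<Rightarrow> 'b set) \<Rightarrow> 'a \<Rightarrow> real set" where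
  "upper_value_set F \<psi> x = {F (x, y) | y. y \<in> \<psi> x}"

(* The sum of sets in A + C is the Minkowski sum. *)
definition l_le :: "real set \<Rightarrow> real set \<Rightarrow> real set \<Rightarrow> bool" where
  "l_le C A B \<longleftrightarrow> B \<subseteq> A + C"

definition global_l_minimal_solution ::
    "real set \<Rightarrow> 'a set \<Rightarrow> ('a \<Rightarrow> real set) \<Rightarrow> 'a \<Rightarrow> bool" where
  "global_l_minimal_solution C X G x\<^sub>0 \<longleftrightarrow>
     x\<^sub>0 \<in> X \<and> (\<forall>x\<in>X. l_le C (G x) (G x\<^sub>0) \<longrightarrow> l_le C (G x\<^sub>0) (G x))"

end

theory Submission
  imports Defs
begin

text \<open>
  For \<open>C = [0, \<infinity>)\<close>, the relation \<open>A \<le>\<^sup>l B\<close> says that every element of \<open>B\<close> lies above some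
  element of \<open>A\<close>.  It therefore compares infima, and, when the infima agree, it also records
  whether they are attained: a set that contains its infimum lies below every set with the same
  or a larger infimum, whereas a set that omits its infimum lies, among the sets with the same
  infimum, below only those that omit it too.

  All optimistic solutions share the least value of \<open>F\<^sub>o\<close>, and anything below one of them
  is again an optimistic solution.  Among them, the points with attained value are thus the smallest
  in the \<open>l\<close>-order.  If some attain the value, exactly these are \<open>l\<close>-minimal; if none does,
  all optimistic solutions are equivalent in the \<open>l\<close>-order and hence minimal.
\<close>

definition optimistic_value_attained ::
    "('a \<times> 'b \<Rightarrow> real) \<Rightarrow> ('a \<Rightarrow> 'b set) \<Rightarrow> 'a \<Rightarrow> bool" where
  "optimistic_value_attained F \<psi> x \<longleftrightarrow> (\<exists>y\<in>\<psi> x. optimistic_value F \<psi> x = ereal (F (x, y)))"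

lemma l_le_nonneg_iff: "l_le {0..} A B \<longleftrightarrow> (\<forall>b\<in>B. \<exists>a\<in>A. a \<le> b)"
proof
  assume "l_le {0..} A B"
  then have sub: "B \<subseteq> A + {0..}"
    by (simp add: l_le_def)
  show "\<forall>b\<in>B. \<exists>a\<in>A. a \<le> b"
  proof
    fix b assume "b \<in> B"
    with sub have "b \<in> A + {0..}"
      by (rule subsetD)
    then obtain a c where "b = a + c" "a \<in> A" "c \<in> {0..}"
      by (rule set_plus_elim)
    then show "\<exists>a\<in>A. a \<le> b"
      by (intro bexI[of _ a]) auto
  qed
next
  assume below: "\<forall>b\<in>B. \<exists>a\<in>A. a \<le> b"
  have "b \<in> A + {0..}" if b: "b \<in> B" for b
  proof -
    obtain a where "a \<in> A" "a \<le> b"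
      using below b by blast
    then have "a + (b - a) \<in> A + {0..}"
      by (intro set_plus_intro) auto
    then show ?thesis
      by simp
  qed
  then show "l_le {0..} A B"
    by (auto simp: l_le_def)
qed

lemma l_le_upper_value_set_iff:
  "l_le {0..} (upper_value_set F \<psi> x) (upper_value_set F \<psi> x') \<longleftrightarrow>
     (\<forall>y'\<in>\<psi> x'. \<exists>y\<in>\<psi> x. F (x, y) \<le> F (x', y'))"
  unfolding l_le_nonneg_iff upper_value_set_def by blast

lemma optimistic_value_le: "y \<in> \<psi> x \<Longrightarrow> optimistic_value F \<psi> x \<le> ereal (F (x, y))"
  unfolding optimistic_value_def by (rule INF_lower)

lemma optimistic_value_mono_l_le:
  assumes "l_le {0..} (upper_value_set F \<psi> x) (upper_value_set F \<psi> x')"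
  shows "optimistic_value F \<psi> x \<le> optimistic_value F \<psi> x'"
  using assms unfolding optimistic_value_def l_le_upper_value_set_iff
  by (intro INF_mono) simp

lemma l_le_if_attained:
  assumes att: "optimistic_value_attained F \<psi> x"
    and le: "optimistic_value F \<psi> x \<le> optimistic_value F \<psi> x'"
  shows "l_le {0..} (upper_value_set F \<psi> x) (upper_value_set F \<psi> x')"
proof -
  obtain y where y: "y \<in> \<psi> x" "optimistic_value F \<psi> x = ereal (F (x, y))"
    using att by (auto simp: optimistic_value_attained_def)
  have "F (x, y) \<le> F (x', y')" if "y' \<in> \<psi> x'" for y'
    using order_trans[OF le optimistic_value_le[of y' \<psi> x' F, OF that]] y(2) by simp
  then show ?thesis
    using y(1) by (auto simp: l_le_upper_value_set_iff)
qed

text \<open>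
  Every value at \<open>x'\<close> lies strictly above the infimum at \<open>x'\<close>, hence strictly above the one at
  \<open>x\<close>; the strict gap leaves room for a value at \<open>x\<close>, attained infimum or not.
\<close>

lemma l_le_if_not_attained:
  assumes not_att: "\<not> optimistic_value_attained F \<psi> x'"
    and le: "optimistic_value F \<psi> x \<le> optimistic_value F \<psi> x'"
  shows "l_le {0..} (upper_value_set F \<psi> x) (upper_value_set F \<psi> x')"
  unfolding l_le_upper_value_set_iff
proof
  fix y' assume y': "y' \<in> \<psi> x'"
  then have "optimistic_value F \<psi> x' < ereal (F (x', y'))"
    using not_att optimistic_value_le[of y' \<psi> x' F]
    by (auto simp: optimistic_value_attained_def less_le)
  with le have "optimistic_value F \<psi> x < ereal (F (x', y'))"
    by (rule le_less_trans)
  then show "\<exists>y\<in>\<psi> x. F (x, y) \<le> F (x', y')"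
    unfolding optimistic_value_def INF_less_iff by (auto intro: less_imp_le)
qed

text \<open>
  A value at \<open>x\<close> below the minimum at \<open>x'\<close> cannot lie below the infimum at \<open>x\<close>, so it is squeezed
  onto that infimum.
\<close>

lemma attained_if_l_le:
  assumes l: "l_le {0..} (upper_value_set F \<psi> x) (upper_value_set F \<psi> x')"
    and att: "optimistic_value_attained F \<psi> x'"
    and ge: "optimistic_value F \<psi> x' \<le> optimistic_value F \<psi> x"
  shows "optimistic_value_attained F \<psi> x"
proof -
  obtain y' where y': "y' \<in> \<psi> x'" "optimistic_value F \<psi> x' = ereal (F (x', y'))"
    using att by (auto simp: optimistic_value_attained_def)
  then obtain y where y: "y \<in> \<psi> x" "F (x, y) \<le> F (x', y')"
    using l by (auto simp: l_le_upper_value_set_iff)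
  have "ereal (F (x, y)) \<le> optimistic_value F \<psi> x"
    using y(2) y'(2) ge by (metis ereal_less_eq(3) order_trans)
  then have "optimistic_value F \<psi> x = ereal (F (x, y))"
    using optimistic_value_le[of y \<psi> x F, OF y(1)] by (rule antisym[rotated])
  then show ?thesis
    using y(1) by (auto simp: optimistic_value_attained_def)
qed

lemma optimistic_solution_if_l_le:
  assumes "global_real_optimistic_solution F X \<psi> x'" and "x \<in> X"
    and "l_le {0..} (upper_value_set F \<psi> x) (upper_value_set F \<psi> x')"
  shows "global_real_optimistic_solution F X \<psi> x"
  using assms(1,2) optimistic_value_mono_l_le[OF assms(3)]
  unfolding global_real_optimistic_solution_def by (meson order_trans)

theorem theorem13:
  fixes X :: "'a::real_normed_vector set"
    and F f :: "'a \<times> 'b::real_normed_vector \<Rightarrow> real"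
    and K \<psi> :: "'a \<Rightarrow> 'b set"
    and Q T :: "'a set"
  assumes X_nonempty: "X \<noteq> {}"
    and psi_eq: "\<psi> = lower_level_solutions f K"
    and psi_nonempty: "\<And>x. x \<in> X \<Longrightarrow> \<psi> x \<noteq> {}"
    and Q_eq: "Q = {x. global_real_optimistic_solution F X \<psi> x}"
    and Q_nonempty: "Q \<noteq> {}"
    and T_eq: "T = {x \<in> Q. \<exists>y\<in>\<psi> x. optimistic_value F \<psi> x = ereal (F (x, y))}"
  shows "(T = {} \<longrightarrow>
            (\<forall>x\<in>Q. global_l_minimal_solution {0..} X (upper_value_set F \<psi>) x)) \<and>
         (T \<noteq> {} \<longrightarrow>
            (\<forall>x\<in>T. global_l_minimal_solution {0..} X (upper_value_set F \<psi>) x) \<and>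
            (\<forall>x\<in>Q - T. \<not> global_l_minimal_solution {0..} X (upper_value_set F \<psi>) x))"
proof -
  have T_iff: "x \<in> T \<longleftrightarrow> x \<in> Q \<and> optimistic_value_attained F \<psi> x" for x
    by (simp add: T_eq optimistic_value_attained_def)
  have Q_in_X: "x \<in> X" if "x \<in> Q" for x
    using that by (simp add: Q_eq global_real_optimistic_solution_def)
  have Q_least: "optimistic_value F \<psi> x \<le> optimistic_value F \<psi> x'" if "x \<in> Q" "x' \<in> X" for x x'
    using that by (simp add: Q_eq global_real_optimistic_solution_def)
  have not_attained: "global_l_minimal_solution {0..} X (upper_value_set F \<psi>) x"
    if "T = {}" "x \<in> Q" for x
    unfolding global_l_minimal_solution_def
  proof (intro conjI ballI impI)
    fix x' assume x': "x' \<in> X" "l_le {0..} (upper_value_set F \<psi> x') (upper_value_set F \<psi> x)"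
    (* x' inherits optimality, so its value is not attained either. *)
    have "x' \<in> Q"
      using optimistic_solution_if_l_le[OF _ x'] that(2) by (simp add: Q_eq)
    then have "\<not> optimistic_value_attained F \<psi> x'"
      using T_iff that(1) by blast
    then show "l_le {0..} (upper_value_set F \<psi> x) (upper_value_set F \<psi> x')"
      using Q_least[OF that(2) x'(1)] by (rule l_le_if_not_attained)
  qed (rule Q_in_X[OF that(2)])
  have attained: "global_l_minimal_solution {0..} X (upper_value_set F \<psi>) x" if "x \<in> T" for x
  proof -
    have "x \<in> Q" "optimistic_value_attained F \<psi> x"
      using that T_iff by auto
    then show ?thesis
      unfolding global_l_minimal_solution_def
      by (simp add: Q_in_X Q_least l_le_if_attained)
  qed
  have excluded: "\<not> global_l_minimal_solution {0..} X (upper_value_set F \<psi>) x"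
    if "t \<in> T" "x \<in> Q - T" for t x
  proof
    assume min: "global_l_minimal_solution {0..} X (upper_value_set F \<psi>) x"
    have t: "t \<in> Q" "optimistic_value_attained F \<psi> t" and x: "x \<in> Q"
      using that T_iff by auto
    have "l_le {0..} (upper_value_set F \<psi> t) (upper_value_set F \<psi> x)"
      by (rule l_le_if_attained[OF t(2) Q_least[OF t(1) Q_in_X[OF x]]])
    then have "l_le {0..} (upper_value_set F \<psi> x) (upper_value_set F \<psi> t)"
      using min Q_in_X[OF t(1)] unfolding global_l_minimal_solution_def by blast
    then have "optimistic_value_attained F \<psi> x"
      using t(2) Q_least[OF t(1) Q_in_X[OF x]] by (rule attained_if_l_le)
    then show False
      using that(2) T_iff by blast
  qed
  show ?thesis
  proof (intro conjI impI)
    assume "T = {}"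
    then show "\<forall>x\<in>Q. global_l_minimal_solution {0..} X (upper_value_set F \<psi>) x"
      by (simp add: not_attained)
  next
    show "\<forall>x\<in>T. global_l_minimal_solution {0..} X (upper_value_set F \<psi>) x"
      by (simp add: attained)
  next
    assume "T \<noteq> {}"
    then obtain t where "t \<in> T"
      by blast
    then show "\<forall>x\<in>Q - T. \<not> global_l_minimal_solution {0..} X (upper_value_set F \<psi>) x"
      using excluded by simp
  qed
qed

end
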